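(* Let $\mathbb{S}=(\mathbb{F}_{p^n},+,\star)$ be a presemifield whose multiplication is given by $x\star y=F(x,y)$, with $F(x,y)=\sum_{i,j=0}^{n-1}a_{ij}x^{p^i}y^{p^j}$ and $a_{ij}\in\mathbb{F}_{p^n}$, and let $\mathbb{F}_q$ be a subfield of $\mathbb{F}_{p^n}$. Let $F_q=\{t_\lambda:\lambda\in\mathbb{F}_q\}$, where $t_\lambda:x\in\mathbb{F}_{p^n}\mapsto\lambda x\in\mathbb{F}_{p^n}$. (A) If there exists $\tau\in\mathrm{Aut}(\mathbb{F}_q)$ such that $F(\lambda x,y)=F(x,\lambda^\tau y)$ for each $x,y\in\mathbb{F}_{p^n}$ and each $\lambda\in\mathbb{F}_q$, then $\mathcal{N}_m(\mathbb{S})$ contains the field of maps $F_q$ and $\mathcal{N}_m(\mathbb{S})\subseteq\mathrm{End}_{\mathbb{F}_q}(\mathbb{F}_{p^n})$. (B) If the polynomial $F$ is $\mathbb{F}_q$-semilinear with respect to $y$, then $\mathcal{N}_r(\mathbb{S})$ contains the field of maps $F_q$ and $\mathcal{N}_r(\mathbb{S})\subseteq\mathrm{End}_{\mathbb{F}_q}(\mathbb{F}_{p^n})$. (C) If the polynomial $F$ is $\mathbb{F}_q$-semilinear with respect to $x$, then $\mathcal{N}_l(\mathbb{S})$ contains the field of maps $F_q$ and $\mathcal{N}_l(\mathbb{S})\subseteq\mathrm{End}_{\mathbb{F}_q}(\mathbb{F}_{p^n})$.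
   Context: $p$ is a prime. A finite presemifield is a finite structure satisfying all axioms of a skewfield except possibly associativity of multiplication and existence of a multiplicative identity. Let $\mathbb{V}=\mathrm{End}_{\mathbb{F}_p}(\mathbb{F}_{p^n})$. The spread set of $\mathbb{S}$ is $\mathcal{C}=\{\varphi_y:y\in\mathbb{F}_{p^n}\}\subset\mathbb{V}$, $\varphi_y(x)=x\star y$; the dual $\mathbb{S}^d$ has multiplication $x\star^d y=y\star x$ and spread set $\mathcal{C}^d$. A field contained in $\mathbb{V}$ is a subset that is a field under addition and composition of maps. $\mathcal{N}_r(\mathbb{S})$ (resp. $\mathcal{N}_m(\mathbb{S})$, $\mathcal{N}_l(\mathbb{S})$) is the largest field in $\mathbb{V}$ with $\mathcal{N}_r(\mathbb{S})\mathcal{C}\subseteq\mathcal{C}$ (resp. $\mathcal{C}\mathcal{N}_m(\mathbb{S})\subseteq\mathcal{C}$, $\mathcal{N}_l(\mathbb{S})\mathcal{C}^d\subseteq\mathcal{C}^d$), products being elementwise compositions. $F$ is $\mathbb{F}_q$-semilinear with respect to $x$ if there is $\sigma\in\mathrm{Aut}(\mathbb{F}_q)$ with $F(\lambda x,y)=\lambda^\sigma F(x,y)$ for all $x,y\in\mathbb{F}_{p^n}$, $\lambda\in\mathbb{F}_q$; similarly with respect to $y$ if there is $\sigma\in\mathrm{Aut}(\mathbb{F}_q)$ with $F(x,\lambda y)=\lambda^\sigma F(x,y)$ for all $x,y\in\mathbb{F}_{p^n}$, $\lambda\in\mathbb{F}_q$. *)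

theory Defs
  imports
    "HOL-Algebra.Algebra"
    "HOL-Algebra.Algebraic_Closure_Type"
    "HOL-Computational_Algebra.Primes"
    "HOL-Library.Cardinality"
begin

text \<open>The finite field with \<open>p ^ n\<close> elements is a type of class \<^class>\<open>finite_field\<close>;
  its subfields are sets \<open>K\<close> with \<open>subfield K ring_of_type_algebra\<close>, and a presemifield on it is
  given by its multiplication, the addition being that of the type.\<close>

text \<open>Following Knuth, the division axiom of a skewfield, which in the absence of an identity
  cannot refer to inverses, is the absence of zero divisors. On a finite structure this is the
  same as unique solvability of \<open>m a x = b\<close> and \<open>m x a = b\<close> for nonzero \<open>a\<close>.\<close>

definition presemifield :: "('a::{ab_group_add, finite} \<Rightarrow> 'a \<Rightarrow> 'a) \<Rightarrow> bool" where
  "presemifield m \<longleftrightarrow>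
     (\<forall>x y z. m (x + y) z = m x z + m y z) \<and>
     (\<forall>x y z. m x (y + z) = m x y + m x z) \<and>
     (\<forall>x y. m x y = 0 \<longrightarrow> x = 0 \<or> y = 0)"

definition dual_mult :: "('a \<Rightarrow> 'a \<Rightarrow> 'a) \<Rightarrow> 'a \<Rightarrow> 'a \<Rightarrow> 'a" where
  "dual_mult m = (\<lambda>x y. m y x)"

definition field_aut :: "'a::field set \<Rightarrow> ('a \<Rightarrow> 'a) set" where
  "field_aut K = ring_iso (ring_of_type_algebra\<lparr>carrier := K\<rparr>) (ring_of_type_algebra\<lparr>carrier := K\<rparr>)"

definition End_over :: "'a::field set \<Rightarrow> ('a \<Rightarrow> 'a) set" where
  "End_over K = {f. (\<forall>x y. f (x + y) = f x + f y) \<and> (\<forall>c\<in>K. \<forall>x. f (c * x) = c * f x)}"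

text \<open>In characteristic \<open>p\<close> the image of the naturals is the prime field.\<close>

definition End_prime :: "('a::finite_field \<Rightarrow> 'a) set" where
  "End_prime = End_over (range of_nat)"

definition maps_ring :: "('a::field \<Rightarrow> 'a) set \<Rightarrow> ('a \<Rightarrow> 'a) \<Rightarrow> ('a \<Rightarrow> 'a) ring" where
  "maps_ring N e = \<lparr>carrier = N, monoid.mult = (\<circ>), one = e, ring.zero = (\<lambda>x. 0),
                    add = (\<lambda>f g x. f x + g x)\<rparr>"

text \<open>The multiplicative identity of a field of maps is not required to be the identity map.
  The zero is necessarily the zero map, since addition is pointwise.\<close>

definition field_of_maps :: "('a::finite_field \<Rightarrow> 'a) set \<Rightarrow> bool" where
  "field_of_maps N \<longleftrightarrow> N \<subseteq> End_prime \<and> (\<exists>e. field (maps_ring N e))"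

definition comp_sets :: "('a \<Rightarrow> 'a) set \<Rightarrow> ('a \<Rightarrow> 'a) set \<Rightarrow> ('a \<Rightarrow> 'a) set" where
  "comp_sets A B = {f \<circ> g | f g. f \<in> A \<and> g \<in> B}"

definition spread_set :: "('a \<Rightarrow> 'a \<Rightarrow> 'a) \<Rightarrow> ('a \<Rightarrow> 'a) set" where
  "spread_set m = range (\<lambda>y x. m x y)"

text \<open>\<open>GREATEST\<close> is with respect to inclusion: each nucleus contains every field of maps having
  the stated property. For a presemifield such a largest field exists: the maps in
  \<^const>\<open>End_prime\<close> satisfying the inclusion form a finite division ring, which is commutative by
  Wedderburn's theorem.\<close>

definition right_nucleus :: "('a::finite_field \<Rightarrow> 'a \<Rightarrow> 'a) \<Rightarrow> ('a \<Rightarrow> 'a) set" where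
  "right_nucleus m =
     (GREATEST N. field_of_maps N \<and> comp_sets N (spread_set m) \<subseteq> spread_set m)"

definition middle_nucleus :: "('a::finite_field \<Rightarrow> 'a \<Rightarrow> 'a) \<Rightarrow> ('a \<Rightarrow> 'a) set" where
  "middle_nucleus m =
     (GREATEST N. field_of_maps N \<and> comp_sets (spread_set m) N \<subseteq> spread_set m)"

definition left_nucleus :: "('a::finite_field \<Rightarrow> 'a \<Rightarrow> 'a) \<Rightarrow> ('a \<Rightarrow> 'a) set" where
  "left_nucleus m =
     (GREATEST N. field_of_maps N \<and>
        comp_sets N (spread_set (dual_mult m)) \<subseteq> spread_set (dual_mult m))"

definition semilinear_x :: "'a::field set \<Rightarrow> ('a \<Rightarrow> 'a \<Rightarrow> 'a) \<Rightarrow> bool" where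
  "semilinear_x K F \<longleftrightarrow> (\<exists>\<sigma>\<in>field_aut K. \<forall>x y. \<forall>l\<in>K. F (l * x) y = \<sigma> l * F x y)"

definition semilinear_y :: "'a::field set \<Rightarrow> ('a \<Rightarrow> 'a \<Rightarrow> 'a) \<Rightarrow> bool" where
  "semilinear_y K F \<longleftrightarrow> (\<exists>\<sigma>\<in>field_aut K. \<forall>x y. \<forall>l\<in>K. F x (l * y) = \<sigma> l * F x y)"

definition scalar_maps :: "'a::field set \<Rightarrow> ('a \<Rightarrow> 'a) set" where
  "scalar_maps K = (\<lambda>c x. c * x) ` K"

end

theory Submission
  imports Defs
begin

text \<open>
  Each nucleus is the largest field among the sets of additive maps whose elements, composed on one
  side with the spread set, map it into itself. Let \<open>M\<close> be the set of all additive maps with this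
  property. Every nonzero element of the spread set is bijective because a presemifield has no zero
  divisors, and from this every nonzero element of \<open>M\<close> is bijective. So \<open>M\<close> is a finite skewfield.

  The existence of a largest field rests on Wedderburn's theorem that a finite skewfield is
  commutative: it says that \<open>M\<close> is a field, so the nucleus is \<open>M\<close> itself
  (\<open>greatest_field_of_maps_over\<close>). The hypotheses in the three parts of the theorem put the
  multiplications by elements of \<open>F\<^sub>q\<close> into \<open>M\<close>: scaling the argument or the value of
  \<open>x \<mapsto> F(x, y)\<close> amounts to replacing \<open>y\<close> by a multiple of \<open>y\<close>, and semilinearity in \<open>x\<close> is
  semilinearity in \<open>y\<close> for the dual. Since \<open>M\<close> is commutative, its elements commute with these multiplications, which means that
  they are \<open>F\<^sub>q\<close>-linear.

  Wedderburn's theorem (\<open>finite_skewfield.wedderburn\<close>) is proved by Witt's method. The class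
  equation of the multiplicative group is compared with an integer that divides the order of the
  group and the size of each class with more than one element, but is too large to divide the number
  of nonzero central elements. That integer is the value of a cyclotomic polynomial at the order of the center
  (\<open>cyclotomic_factor_exists\<close>).
\<close>

section \<open>A cyclotomic factor of \<open>X\<^sup>n - 1\<close>\<close>

lemma poly_of_int_mult:
  "poly (map_poly of_int (p * q)) (z::complex) = poly (map_poly of_int p) z * poly (map_poly of_int q) z"
proof -
  have "map_poly of_int (p * q) = (map_poly of_int p * map_poly of_int q :: complex poly)"
    by (rule poly_eqI) (simp add: coeff_map_poly coeff_mult)
  then show ?thesis by simp
qed

lemma poly_of_int_of_int:
  "poly (map_poly of_int p) (of_int k :: complex) = of_int (poly p k)"
  by (induction p) (simp_all add: map_poly_pCons)

text \<open>Evaluation at \<open>z\<close> is multiplicative, so one of the prime factors in \<open>\<int>[X]\<close> has to take the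
value \<open>0\<close>. Primality in \<open>\<int>[X]\<close>, rather than irreducibility over \<open>\<rat>\<close>, is what later yields
divisibility between integers.\<close>

lemma prime_factor_at_root:
  fixes p :: "int poly" and z :: complex
  assumes "p \<noteq> 0" "poly (map_poly of_int p) z = 0"
  shows "\<exists>r. Factorial_Ring.prime r \<and> r dvd p \<and> poly (map_poly of_int r) z = 0"
  using assms
proof (induction p rule: prime_divisors_induct)
  case (unit x)
  then obtain y where "x * y = 1" by (auto elim: dvdE)
  then have "poly (map_poly of_int (x * y)) z = 1" by simp
  with unit show ?case by (simp add: poly_of_int_mult)
next
  case (factor r x)
  then show ?case by (auto simp: poly_of_int_mult intro: dvd_mult dvd_mult2)
qed simp

text \<open>The value at \<open>z\<close> is the leading coefficient times the product of the differences \<open>z - r\<close> over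
the roots \<open>r\<close>. Since \<open>m \<ge> 1\<close>, a nonempty product of factors of modulus greater than \<open>m\<close> still
has modulus greater than \<open>m\<close>; the degree is positive, so there is at least one factor.\<close>

lemma norm_poly_gt_if_roots_far:
  fixes p :: "complex poly"
  assumes "degree p > 0" "norm (lead_coeff p) \<ge> 1" "m \<ge> 1"
    and far: "\<And>r. poly p r = 0 \<Longrightarrow> norm (z - r) > m"
  shows "norm (poly p z) > m"
proof -
  have "p \<noteq> 0" using assms by auto
  then obtain A where A: "size A = degree p" "p = smult (lead_coeff p) (\<Prod>x\<in>#A. [:-x, 1:])"
    using alg_closed_imp_factorization by blast
  have roots: "poly p r = 0" if "r \<in># A" for r
    using that by (subst A(2)) (auto simp: poly_prod_mset dest!: multi_member_split)
  have prod: "norm (\<Prod>x\<in>#B. z - x) > m" if "B \<noteq> {#}" "\<forall>x\<in>#B. norm (z - x) > m" for B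
    using that
  proof (induction B)
    case (add x B)
    have x: "norm (z - x) > m" using add.prems by simp
    show ?case
    proof (cases "B = {#}")
      case False
      then have "norm (\<Prod>x\<in>#B. z - x) > m" using add by auto
      then have "m * 1 < norm (z - x) * norm (\<Prod>x\<in>#B. z - x)"
        using x \<open>m \<ge> 1\<close> by (intro mult_strict_mono) auto
      then show ?thesis by (simp add: norm_mult)
    qed (use x in simp)
  qed simp
  have "A \<noteq> {#}" using A(1) assms(1) by auto
  with prod far roots have "m < norm (\<Prod>x\<in>#A. z - x)" by blast
  also have "\<dots> \<le> norm (lead_coeff p) * norm (\<Prod>x\<in>#A. z - x)"
    using assms(2) by (simp add: mult_le_cancel_right1)
  also have "\<dots> = norm (poly p z)" by (subst (3) A(2)) (simp add: poly_prod_mset norm_mult)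
  finally show ?thesis .
qed

lemma dist_unit_circle_gt:
  fixes z :: complex and q :: real
  assumes "norm z = 1" "z \<noteq> 1" "q > 0"
  shows "norm (of_real q - z) > q - 1"
proof -
  have sq: "Re z ^ 2 + Im z ^ 2 = 1" using assms(1) by (simp add: norm_complex_def)
  have "Re z < 1"
  proof (rule ccontr)
    assume "\<not> Re z < 1"
    moreover have "Re z \<le> 1" using complex_Re_le_cmod[of z] assms(1) by simp
    ultimately have "Re z = 1" by simp
    with sq have "Im z = 0" by simp
    with \<open>Re z = 1\<close> have "z = 1" by (simp add: complex_eq_iff)
    with assms(2) show False by simp
  qed
  then have "q - 1 < q - Re z" by simp
  also have "\<dots> = Re (of_real q - z)" by simp
  also have "\<dots> \<le> norm (of_real q - z)" by (rule complex_Re_le_cmod)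
  finally show ?thesis .
qed

text \<open>The witness is the \<open>n\<close>-th cyclotomic polynomial, obtained as a prime factor of \<open>X\<^sup>n - 1\<close> in
\<open>\<int>[X]\<close> that vanishes at a primitive \<open>n\<close>-th root of unity. For a proper divisor \<open>d\<close> of
\<open>n\<close> it cannot divide \<open>X\<^sup>d - 1\<close>, which is nonzero at that root, so being prime it divides the cofactor of \<open>X\<^sup>d - 1\<close> in \<open>X\<^sup>n - 1\<close>; the first property follows by
evaluation at \<open>q\<close>. All its roots lie on the unit circle, and none of them is \<open>1\<close>, so each is at
a distance greater than \<open>q - 1 \<ge> 1\<close> from \<open>q\<close>; this gives the second property.\<close>

lemma cyclotomic_factor_exists:
  fixes n :: nat
  assumes "n \<ge> 2"
  obtains P :: "int poly" where
    "\<And>d q. d dvd n \<Longrightarrow> d < n \<Longrightarrow> poly P q * (q ^ d - 1) dvd q ^ n - 1"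
    "\<And>q. q \<ge> 2 \<Longrightarrow> \<bar>poly P q\<bar> > q - 1"
proof -
  define z where "z = cis (2 * pi / n)"
  define f :: "nat \<Rightarrow> int poly" where "f = (\<lambda>d. (Polynomial.monom 1 d - 1 :: int poly))"
  have eval: "poly (map_poly of_int (f d)) w = w ^ d - 1" for d and w :: complex
  proof -
    have "map_poly of_int (f d) = (Polynomial.monom 1 d - 1 :: complex poly)"
      by (rule poly_eqI) (auto simp: f_def coeff_map_poly coeff_1)
    then show ?thesis by (simp add: poly_monom)
  qed
  have evali: "poly (f d) q = q ^ d - 1" for d q by (simp add: f_def poly_monom)
  have zn: "z ^ n = 1" using assms by (simp add: z_def DeMoivre)
  have zd: "z ^ d \<noteq> 1" if "0 < d" "d < n" for d
  proof
    assume "z ^ d = 1"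
    then have "cis (2 * pi * real d / real n) = cis (2 * pi * real 0 / real n)"
      by (simp add: z_def DeMoivre mult.commute)
    moreover have "inj_on (\<lambda>k. cis (2 * pi * real k / real n)) {..<n}"
      using bij_betw_roots_unity[of n] assms by (simp add: bij_betw_def)
    ultimately have "d = 0" using that by (elim inj_onD) auto
    then show False using that by simp
  qed
  have "f n \<noteq> 0"
  proof
    assume "f n = 0"
    then have "(2::int) ^ n = 1" using evali[of n 2] by simp
    then show False using assms by simp
  qed
  moreover have "poly (map_poly of_int (f n)) z = 0" by (simp add: eval zn)
  ultimately obtain P where P: "Factorial_Ring.prime P" "P dvd f n" "poly (map_poly of_int P) z = 0"
    using prime_factor_at_root by blast
  have quot: "\<exists>Q. f n = f d * (P * Q)" if d: "d dvd n" "d < n" for d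
  proof -
    have "0 < d" using d assms by (auto intro: Nat.gr0I)
    obtain k where k: "n = d * k" using d by auto
    have "f d dvd f n"
      using power_diff_1_eq[of "Polynomial.monom 1 d :: int poly" k]
      by (simp add: f_def k monom_power)
    then obtain Y where Y: "f n = f d * Y" by (elim dvdE)
    have "\<not> P dvd f d"
    proof
      assume "P dvd f d"
      then have "poly (map_poly of_int (f d)) z = 0"
        using P(3) by (auto elim!: dvdE simp: poly_of_int_mult)
      then show False using zd[OF \<open>0 < d\<close> d(2)] by (simp add: eval)
    qed
    with P Y have "P dvd Y" by (metis prime_dvd_multD)
    with Y show ?thesis by (auto elim!: dvdE)
  qed
  have "poly P q * (q ^ d - 1) dvd q ^ n - 1" if d: "d dvd n" "d < n" for d q
  proof -
    obtain Q where "f n = f d * (P * Q)" using quot[OF d] by blast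
    then have "q ^ n - 1 = (q ^ d - 1) * (poly P q * poly Q q)"
      by (metis evali poly_mult)
    then show ?thesis by simp
  qed
  moreover have "\<bar>poly P q\<bar> > q - 1" if q: "q \<ge> 2" for q
  proof -
    let ?P = "map_poly of_int P :: complex poly"
    have P0: "P \<noteq> 0" using P(1) by auto
    have lc: "lead_coeff ?P = of_int (lead_coeff P)" 
      by (simp add: lead_coeff_map_poly_nz P0)
    have P0': "?P \<noteq> 0" using P0 by (simp add: map_poly_eq_0_iff)
    have "norm (of_int q - r) > q - 1" if r: "poly ?P r = 0" for r
    proof -
      have "poly (map_poly of_int (f n)) r = 0"
        using P(2) r by (auto elim!: dvdE simp: poly_of_int_mult)
      then have "r ^ n = 1" by (simp add: eval)
      then have "norm r = 1" using assms by (auto dest: power_eq_1_iff)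
      moreover have "r \<noteq> 1"
      proof
        assume "r = 1"
        with r have "poly P 1 = 0" using poly_of_int_of_int[of P 1] by simp
        moreover obtain Q where "f n = f 1 * (P * Q)" using quot[of 1] assms by auto
        \<comment> \<open>If \<open>P\<close> vanished at \<open>1\<close>, then \<open>1\<close> would be a double root of \<open>X\<^sup>n - 1\<close>, as \<open>X - 1\<close> is a further factor.\<close>
        ultimately have "poly (pderiv (f n)) 1 = 0" by (simp add: pderiv_mult evali)
        then show False using assms by (simp add: f_def pderiv_diff pderiv_monom poly_monom)
      qed
      ultimately show ?thesis using dist_unit_circle_gt[of r "of_int q"] q by simp
    qed
    moreover have "degree ?P > 0"
      using P(3) P0' by (auto intro!: Nat.gr0I elim!: degree_eq_zeroE)
    moreover have "norm (lead_coeff ?P) \<ge> 1"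
    proof -
      have "lead_coeff P \<noteq> 0" using P0 by simp
      then have "1 \<le> \<bar>lead_coeff P\<bar>" by linarith
      then show ?thesis unfolding lc by (metis norm_of_int of_int_1_le_iff of_int_abs)
    qed
    ultimately have "norm (poly ?P (of_int q)) > q - 1" 
      using q by (intro norm_poly_gt_if_roots_far) auto
    then show ?thesis by (simp add: poly_of_int_of_int)
  qed
  ultimately show ?thesis using that by blast
qed

section \<open>The class equation modulo an integer\<close>

text \<open>This is the class equation read modulo \<open>k\<close>. The elements outside the center split into conjugacy
classes, and the class of \<open>a\<close> has as many elements as the index of the centralizer of \<open>a\<close>. The
hypothesis on centralizers says that \<open>k\<close> divides these indices, so \<open>k\<close> divides the number of
noncentral elements as well as the order of the group.\<close>

lemma (in group) dvd_card_center:
  assumes fin: "finite (carrier G)" 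
    and Z: "Z = {z \<in> carrier G. \<forall>x\<in>carrier G. z \<otimes> x = x \<otimes> z}"
    and k: "k dvd Coset.order G"
    and cent: "\<And>a. a \<in> carrier G - Z \<Longrightarrow> k * card {x \<in> carrier G. x \<otimes> a = a \<otimes> x} dvd Coset.order G"
  shows "k dvd card Z"
proof -
  define \<phi> where "\<phi> = (\<lambda>g. \<lambda>h\<in>carrier G. g \<otimes> h \<otimes> inv g)"
  interpret act: group_action G "carrier G" \<phi>
    unfolding \<phi>_def by (rule action_by_conjugation)
  have conj_eq: "\<phi> g a = b \<longleftrightarrow> g \<otimes> a = b \<otimes> g"
    if "g \<in> carrier G" "a \<in> carrier G" "b \<in> carrier G" for g a b
    using that inv_solve_right'[of b "g \<otimes> a" g] by (simp add: \<phi>_def)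
  have stab: "stabilizer G \<phi> a = {x \<in> carrier G. x \<otimes> a = a \<otimes> x}" if "a \<in> carrier G" for a
    using that by (auto simp: stabilizer_def conj_eq)
  have orbit_central: "orbit G \<phi> z = {z}" if "z \<in> Z" for z
  proof -
    have z: "z \<in> carrier G" "\<phi> g z = z" if "g \<in> carrier G" for g
      using \<open>z \<in> Z\<close> that conj_eq[of g z z] by (auto simp: Z)
    have "orbit G \<phi> z = (\<lambda>g. \<phi> g z) ` carrier G" by (auto simp: orbit_def)
    also have "\<dots> = (\<lambda>g. z) ` carrier G" by (intro image_cong) (simp_all add: z)
    also have "\<dots> = {z}" using one_closed by blast
    finally show ?thesis .
  qed
  define C where "C = orbit G \<phi> ` (carrier G - Z)"
  have sub: "orbit G \<phi> a \<subseteq> carrier G - Z" if "a \<in> carrier G - Z" for a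
  proof
    fix b assume b: "b \<in> orbit G \<phi> a"
    then have bG: "b \<in> carrier G" using that by (auto simp: orbit_def \<phi>_def)
    have "a \<in> orbit G \<phi> b" using that bG by (intro act.orbit_sym[OF _ _ b]) simp_all
    then show "b \<in> carrier G - Z" using that bG orbit_central by auto
  qed
  have union: "\<Union>C = carrier G - Z"
    using sub act.orbit_refl unfolding C_def by blast
  have "k dvd card (\<Union>C)"
  proof (rule dvd_partition)
    show "finite (\<Union>C)" using fin union by simp
    show "\<forall>c\<in>C. k dvd card c"
    proof
      fix c assume "c \<in> C"
      then obtain a where a: "a \<in> carrier G - Z" "c = orbit G \<phi> a" by (auto simp: C_def)
      let ?S = "{x \<in> carrier G. x \<otimes> a = a \<otimes> x}"
      have "card c * card ?S = Coset.order G"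
        using act.orbit_stabilizer_theorem[of a] a stab[of a] by auto
      moreover from this have "card ?S > 0"
        using fin order_gt_0_iff_finite by (intro Nat.gr0I) auto
      moreover have "k * card ?S dvd Coset.order G" by (rule cent[OF a(1)])
      ultimately have "k * card ?S dvd card c * card ?S" "card ?S \<noteq> 0" by simp_all
      then show "k dvd card c" by simp
    qed
    show "\<forall>c1\<in>C. \<forall>c2\<in>C. c1 \<noteq> c2 \<longrightarrow> c1 \<inter> c2 = {}"
    proof (intro ballI impI)
      fix c1 c2 assume "c1 \<in> C" "c2 \<in> C" "c1 \<noteq> c2"
      then show "c1 \<inter> c2 = {}"
        using act.disjoint_union[of c1 c2] by (auto simp: C_def orbits_def)
    qed
  qed
  then have "k dvd card (carrier G - Z)" by (simp add: union)
  moreover have "card (carrier G - Z) + card Z = Coset.order G"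
  proof -
    have "Z \<subseteq> carrier G" unfolding Z by blast
    then show ?thesis
      using card_Diff_subset[of Z "carrier G"] card_mono[OF fin] finite_subset[OF _ fin]
      by (simp add: Coset.order_def)
  qed
  ultimately show ?thesis using k by (metis dvd_add_right_iff)
qed

section \<open>Wedderburn's theorem\<close>

locale finite_skewfield = ring R for R (structure) +
  assumes finite_carrier: "finite (carrier R)"
    and Units_eq: "Units R = carrier R - {\<zero>}"
begin

lemma one_neq_zero: "\<one> \<noteq> \<zero>"
  using Units_eq by blast

lemma inv_mem: "x \<in> carrier R \<Longrightarrow> x \<noteq> \<zero> \<Longrightarrow> inv x \<in> carrier R"
  using Units_eq by auto

lemma l_inv_nonzero: "x \<in> carrier R \<Longrightarrow> x \<noteq> \<zero> \<Longrightarrow> inv x \<otimes> x = \<one>"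
  and r_inv_nonzero: "x \<in> carrier R \<Longrightarrow> x \<noteq> \<zero> \<Longrightarrow> x \<otimes> inv x = \<one>"
  using Units_eq by auto

definition subskewfield :: "'a set \<Rightarrow> bool" where
  "subskewfield K \<longleftrightarrow> subring K R \<and> (\<forall>x\<in>K - {\<zero>}. inv x \<in> K)"

definition centralizer :: "'a set \<Rightarrow> 'a set" where
  "centralizer S = {x \<in> carrier R. \<forall>s\<in>S. x \<otimes> s = s \<otimes> x}"

lemma subskewfield_centralizer:
  assumes "S \<subseteq> carrier R"
  shows "subskewfield (centralizer S)"
proof -
  have "subring (centralizer S) R"
  proof (rule subringI)
    show "\<ominus> x \<in> centralizer S" if "x \<in> centralizer S" for x
      using that assms by (auto simp: centralizer_def l_minus r_minus subset_iff)
    show "x \<otimes> y \<in> centralizer S" if "x \<in> centralizer S" "y \<in> centralizer S" for x y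
    proof -
      have "x \<otimes> y \<otimes> s = s \<otimes> (x \<otimes> y)" if s: "s \<in> S" for s
      proof -
        have c: "x \<in> carrier R" "y \<in> carrier R" "s \<in> carrier R" "x \<otimes> s = s \<otimes> x" "y \<otimes> s = s \<otimes> y"
          using \<open>x \<in> _\<close> \<open>y \<in> _\<close> s assms by (auto simp: centralizer_def)
        then show ?thesis by (metis m_assoc)
      qed
      then show ?thesis using that by (auto simp: centralizer_def)
    qed
    show "x \<oplus> y \<in> centralizer S" if "x \<in> centralizer S" "y \<in> centralizer S" for x y
      using that assms by (auto simp: centralizer_def l_distr r_distr subset_iff)
  qed (use assms in \<open>auto simp: centralizer_def\<close>)
  moreover have "inv x \<in> centralizer S" if "x \<in> centralizer S - {\<zero>}" for x
  proof -
    have x: "x \<in> carrier R" "x \<noteq> \<zero>" using that by (auto simp: centralizer_def)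
    have "inv x \<otimes> s = s \<otimes> inv x" if s: "s \<in> S" for s
    proof -
      have c: "s \<in> carrier R" "x \<otimes> s = s \<otimes> x"
        using \<open>x \<in> _ - _\<close> s assms by (auto simp: centralizer_def)
      have "inv x \<otimes> s = inv x \<otimes> s \<otimes> (x \<otimes> inv x)"
        using x c by (simp add: r_inv_nonzero inv_mem)
      also have "\<dots> = inv x \<otimes> (s \<otimes> x) \<otimes> inv x"
        using x c by (simp add: m_assoc inv_mem)
      also have "\<dots> = inv x \<otimes> x \<otimes> s \<otimes> inv x"
        unfolding c(2)[symmetric] using x c(1) by (simp add: m_assoc inv_mem)
      also have "\<dots> = s \<otimes> inv x"
        using x c by (simp add: l_inv_nonzero inv_mem)
      finally show ?thesis .
    qed
    then show ?thesis using x by (simp add: centralizer_def inv_mem)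
  qed
  ultimately show ?thesis by (simp add: subskewfield_def)
qed

definition left_subspace :: "'a set \<Rightarrow> 'a set \<Rightarrow> bool" where
  "left_subspace K V \<longleftrightarrow> V \<subseteq> carrier R \<and> \<zero> \<in> V \<and>
     (\<forall>x\<in>V. \<forall>y\<in>V. x \<oplus> y \<in> V) \<and> (\<forall>k\<in>K. \<forall>x\<in>V. k \<otimes> x \<in> V)"

text \<open>This is the dimension count for left vector spaces over a possibly noncommutative \<open>K\<close>. In place of
bases, a largest subspace \<open>V\<close> of \<open>M\<close> whose cardinality is a power of \<open>|K|\<close> is considered: if some
\<open>x \<in> M\<close> were outside \<open>V\<close>, then \<open>V \<oplus> K x\<close> would be larger by the factor \<open>|K|\<close>.\<close>

lemma card_left_subspace:
  assumes K: "subskewfield K" and M: "left_subspace K M"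
  shows "\<exists>m. card M = card K ^ m"
proof -
  define sub where "sub V \<longleftrightarrow> left_subspace K V \<and> V \<subseteq> M \<and> (\<exists>m. card V = card K ^ m)" for V
  have "subring K R" using K by (simp add: subskewfield_def)
  note K_closed = subringE[OF this]
  have KR: "K \<subseteq> carrier R" by (rule K_closed)
  have finM: "finite M" using M finite_carrier finite_subset by (auto simp: left_subspace_def)
  have "sub {\<zero>}"
    using KR M by (auto simp: sub_def left_subspace_def subset_iff intro!: exI[of _ 0])
  moreover have "\<forall>V. sub V \<longrightarrow> card V < Suc (card M)"
    using finM by (auto simp: sub_def less_Suc_eq_le intro: card_mono)
  ultimately obtain V where V: "sub V" and max: "\<And>W. sub W \<Longrightarrow> card W \<le> card V"
    using ex_has_greatest_nat[of sub "{\<zero>}" card "Suc (card M)"] by auto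
  have VR: "V \<subseteq> carrier R" and V_zero: "\<zero> \<in> V"
    and V_add: "\<And>x y. x \<in> V \<Longrightarrow> y \<in> V \<Longrightarrow> x \<oplus> y \<in> V"
    and V_scale: "\<And>k x. k \<in> K \<Longrightarrow> x \<in> V \<Longrightarrow> k \<otimes> x \<in> V"
    using V by (auto simp: sub_def left_subspace_def)
  have "V = M"
  proof (rule ccontr)
    assume "V \<noteq> M"
    then obtain x where x: "x \<in> M" "x \<notin> V" using V by (auto simp: sub_def)
    have xR: "x \<in> carrier R" using x M by (auto simp: left_subspace_def)
    define h where "h = (\<lambda>(v, k). v \<oplus> k \<otimes> x)"
    define W where "W = h ` (V \<times> K)"
    have hR: "v \<oplus> k \<otimes> x \<in> carrier R" if "v \<in> V" "k \<in> K" for v k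
      using that VR KR xR by auto
    \<comment> \<open>The sum of \<open>V\<close> and \<open>K x\<close> is direct, since a nonzero multiple of \<open>x\<close> in \<open>V\<close> could be divided by its coefficient.\<close>
    have inj: "inj_on h (V \<times> K)"
    proof (rule inj_onI, clarsimp simp: h_def)
      fix v k v' k'
      assume a: "v \<in> V" "k \<in> K" "v' \<in> V" "k' \<in> K" "v \<oplus> k \<otimes> x = v' \<oplus> k' \<otimes> x"
      then have c: "v \<in> carrier R" "k \<in> carrier R" "v' \<in> carrier R" "k' \<in> carrier R"
        using VR KR by auto
      have eq: "(k \<ominus> k') \<otimes> x = v' \<ominus> v"
      proof -
        have "(k \<ominus> k') \<otimes> x = (v \<oplus> k \<otimes> x) \<ominus> v \<ominus> k' \<otimes> x"
          using c xR by algebra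
        also have "\<dots> = (v' \<oplus> k' \<otimes> x) \<ominus> v \<ominus> k' \<otimes> x" by (simp only: a(5))
        also have "\<dots> = v' \<ominus> v" using c xR by algebra
        finally show ?thesis .
      qed
      \<comment> \<open>Subspaces are closed under subtraction because \<open>K\<close> contains \<open>-1\<close>.\<close>
      have "v' \<ominus> v = v' \<oplus> (\<ominus> \<one>) \<otimes> v" using c by algebra
      then have diffV: "v' \<ominus> v \<in> V" using a K_closed by (simp add: V_add V_scale)
      have diffK: "k \<ominus> k' \<in> K" using a K_closed by (simp add: a_minus_def)
      have "k \<ominus> k' = \<zero>"
      proof (rule ccontr)
        assume nz: "k \<ominus> k' \<noteq> \<zero>"
        then have iK: "inv (k \<ominus> k') \<in> K" using K diffK by (auto simp: subskewfield_def)
        have "x = inv (k \<ominus> k') \<otimes> ((k \<ominus> k') \<otimes> x)"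
          using nz diffK KR xR iK by (auto simp: m_assoc[symmetric] l_inv_nonzero subset_iff)
        also have "\<dots> \<in> V" unfolding eq using iK diffV by (rule V_scale)
        finally show False using x by simp
      qed
      then have "k = k'" using c by simp
      moreover from this have "v = v'" using a c xR by simp
      ultimately show "v = v' \<and> k = k'" by simp
    qed
    have "sub W"
      unfolding sub_def left_subspace_def
    proof (intro conjI ballI)
      show "W \<subseteq> carrier R" using hR by (auto simp: W_def h_def)
      show "\<zero> \<in> W"
        unfolding W_def using xR V_zero K_closed(2)
        by (intro image_eqI[of _ _ "(\<zero>, \<zero>)"]) (auto simp: h_def)
      show "W \<subseteq> M"
        using V x M by (auto simp: W_def h_def sub_def left_subspace_def)
      show "w \<oplus> w' \<in> W" if "w \<in> W" "w' \<in> W" for w w'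
      proof -
        obtain v l v' l' where w: "v \<in> V" "l \<in> K" "w = v \<oplus> l \<otimes> x"
          and w': "v' \<in> V" "l' \<in> K" "w' = v' \<oplus> l' \<otimes> x"
          using \<open>w \<in> W\<close> \<open>w' \<in> W\<close> by (auto simp: W_def h_def)
        have c: "v \<in> carrier R" "l \<in> carrier R" "v' \<in> carrier R" "l' \<in> carrier R"
          using w w' VR KR by auto
        have "w \<oplus> w' = h (v \<oplus> v', l \<oplus> l')"
          unfolding w w' h_def prod.case using c xR by algebra
        then show ?thesis using w w' K_closed V_add by (auto simp: W_def)
      qed
      show "k \<otimes> w \<in> W" if "k \<in> K" "w \<in> W" for k w
      proof -
        obtain v l where w: "v \<in> V" "l \<in> K" "w = v \<oplus> l \<otimes> x"
          using \<open>w \<in> W\<close> by (auto simp: W_def h_def)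
        have "k \<otimes> w = h (k \<otimes> v, k \<otimes> l)"
          using w that VR KR xR by (auto simp: h_def r_distr m_assoc subset_iff)
        then show ?thesis using that w V_scale K_closed by (auto simp: W_def)
      qed
      obtain m where "card V = card K ^ m" using V by (auto simp: sub_def)
      then have "card W = card K ^ Suc m"
        unfolding W_def card_image[OF inj] by (simp add: card_cartesian_product)
      then show "\<exists>m. card W = card K ^ m" ..
    qed
    then have "card W \<le> card V" by (rule max)
    moreover have "V \<subset> W"
    proof -
      have "v \<in> W" if "v \<in> V" for v
        using that VR xR K_closed(2) by (force simp: W_def h_def)
      moreover have "x \<in> W" 
        unfolding W_def using xR V_zero K_closed(3)
        by (intro image_eqI[of _ _ "(\<zero>, \<one>)"]) (auto simp: h_def)
      ultimately show ?thesis using x by auto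
    qed
    moreover have "finite W"
      using finite_subset[OF VR finite_carrier] finite_subset[OF KR finite_carrier] by (simp add: W_def)
    ultimately show False using psubset_card_mono[of W V] by simp
  qed
  then show ?thesis using V by (auto simp: sub_def)
qed

text \<open>Witt's argument. Let \<open>q\<close> be the size of the center \<open>Z\<close> and \<open>q\<^sup>n\<close> the size of \<open>R\<close>, and suppose
\<open>n \<ge> 2\<close>. The centralizer of a noncentral \<open>a\<close> is a vector space over \<open>Z\<close> and \<open>R\<close> is a vector space
over it, so it has \<open>q\<^sup>d\<close> elements for a proper divisor \<open>d\<close> of \<open>n\<close>. With \<open>k = |P(q)|\<close>, where \<open>P\<close> is
the polynomial of \<open>cyclotomic_factor_exists\<close>, every index \<open>(q\<^sup>n - 1) / (q\<^sup>d - 1)\<close> is divisible by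
\<open>k\<close>, and hence so is the number \<open>q - 1\<close> of nonzero central elements. But \<open>k > q - 1\<close>.\<close>

theorem commutative:
  assumes "x \<in> carrier R" "y \<in> carrier R"
  shows "x \<otimes> y = y \<otimes> x"
proof -
  define Z where "Z = centralizer (carrier R)"
  define q where "q = card Z"
  have sZ: "subskewfield Z" unfolding Z_def by (rule subskewfield_centralizer) simp
  have "subring Z R" using sZ by (simp add: subskewfield_def)
  note Z_closed = subringE[OF this]
  have finZ: "finite Z" using Z_closed(1) finite_carrier finite_subset by blast
  have "{\<zero>, \<one>} \<subseteq> Z" using Z_closed(2,3) by auto
  then have "card {\<zero>, \<one>} \<le> q" unfolding q_def using finZ by (rule card_mono[rotated])
  then have q2: "q \<ge> 2" using one_neq_zero by simp
  have carrier_pow: "\<exists>m. card (carrier R) = card K ^ m" if "subskewfield K" for K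
    using that subringE(1)[of K R]
    by (intro card_left_subspace) (auto simp: subskewfield_def left_subspace_def)
  obtain n where n: "card (carrier R) = q ^ n" using carrier_pow[OF sZ] by (auto simp: q_def)
  show ?thesis
  proof (cases "n \<ge> 2")
    case False
    have "carrier R = Z"
    proof (rule card_subset_eq[symmetric])
      have "card Z \<le> card (carrier R)" using Z_closed(1) finite_carrier by (rule card_mono[rotated])
      moreover have "q ^ n \<le> q ^ 1" using False q2 by (intro power_increasing[of n 1 q]) simp_all
      ultimately show "card Z = card (carrier R)" unfolding n q_def[symmetric] by simp
    qed (use finite_carrier Z_closed(1) in auto)
    then show ?thesis using assms by (auto simp: Z_def centralizer_def)
  next
    case True
    obtain P :: "int poly" where P: "\<And>d q. d dvd n \<Longrightarrow> d < n \<Longrightarrow> poly P q * (q ^ d - 1) dvd q ^ n - 1"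
      "\<And>q. q \<ge> 2 \<Longrightarrow> \<bar>poly P q\<bar> > q - 1"
      using cyclotomic_factor_exists[OF True] by blast
    define k where "k = nat \<bar>poly P (int q)\<bar>"
    have k: "k * (q ^ d - 1) dvd q ^ n - 1" if "d dvd n" "d < n" for d
    proof -
      have "int (q ^ m - 1) = int q ^ m - 1" for m using q2 by (simp add: of_nat_diff)
      moreover have "\<bar>poly P (int q)\<bar> * (int q ^ d - 1) dvd int q ^ n - 1"
      proof -
        have "\<bar>poly P (int q)\<bar> * (int q ^ d - 1) dvd poly P (int q) * (int q ^ d - 1)"
          by (rule mult_dvd_mono) auto
        then show ?thesis using P(1)[OF that] by (rule dvd_trans)
      qed
      ultimately have "int (k * (q ^ d - 1)) dvd int (q ^ n - 1)" by (simp add: k_def)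
      then show ?thesis by (simp only: of_nat_dvd_iff)
    qed
    interpret U: group "units_of R" by (rule units_group)
    have U: "carrier (units_of R) = carrier R - {\<zero>}" "monoid.mult (units_of R) = monoid.mult R"
      by (simp_all add: units_of_def Units_eq)
    have ord: "Coset.order (units_of R) = q ^ n - 1"
      using finite_carrier by (simp add: Coset.order_def U n)
    have zero_comm: "z \<otimes> \<zero> = \<zero> \<otimes> z" if "z \<in> carrier R" for z using that by simp
    have cU: "{x \<in> carrier (units_of R). x \<otimes> a = a \<otimes> x} = centralizer {a} - {\<zero>}" for a
      by (auto simp: U centralizer_def)
    have "k dvd card (Z - {\<zero>})"
    proof (rule U.dvd_card_center)
      show "finite (carrier (units_of R))" using finite_carrier by (simp add: U)
      show "Z - {\<zero>} = {z \<in> carrier (units_of R). \<forall>x\<in>carrier (units_of R).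
          z \<otimes>\<^bsub>units_of R\<^esub> x = x \<otimes>\<^bsub>units_of R\<^esub> z}"
        using zero_comm by (auto simp: Z_def centralizer_def U)
      \<comment> \<open>The divisor \<open>d = 1\<close> of \<open>n\<close> is proper, so \<open>k\<close> divides the order of the group as well.\<close>
      have "k dvd k * (q ^ 1 - 1)" by simp
      also have "\<dots> dvd q ^ n - 1" using True by (intro k) auto
      finally show "k dvd Coset.order (units_of R)" by (simp add: ord)
      fix a assume "a \<in> carrier (units_of R) - (Z - {\<zero>})"
      then have a: "a \<in> carrier R" "a \<notin> Z" by (auto simp: U)
      define C where "C = centralizer {a}"
      have sC: "subskewfield C" unfolding C_def using a by (intro subskewfield_centralizer) auto
      have "subring C R" using sC by (simp add: subskewfield_def)
      note C_closed = subringE[OF this]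
      have finC: "finite C" using C_closed(1) finite_carrier finite_subset by blast
      have "Z \<subseteq> C" using a by (auto simp: C_def Z_def centralizer_def)
      then obtain d where d: "card C = q ^ d"
        using card_left_subspace[OF sZ, of C] C_closed
        by (auto simp: left_subspace_def q_def subset_iff)
      obtain m where m: "card (carrier R) = card C ^ m" using carrier_pow[OF sC] by blast
      have "q ^ n = q ^ (d * m)" using n m d by (simp add: power_mult)
      then have "n = d * m" using q2 by (simp add: power_inject_exp)
      moreover have "C \<noteq> carrier R"
      proof
        assume "C = carrier R"
        then have "y \<otimes> a = a \<otimes> y" if "y \<in> carrier R" for y
          using that by (auto simp: C_def centralizer_def)
        then have "a \<in> Z" using a by (simp add: Z_def centralizer_def)
        with a show False by simp
      qed
      then have "C \<subset> carrier R" using C_closed(1) by auto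
      then have "card C < card (carrier R)" by (rule psubset_card_mono[OF finite_carrier])
      then have "q ^ d < q ^ n" by (simp add: d n)
      then have "d < n" using q2 by simp
      ultimately have "k * (q ^ d - 1) dvd q ^ n - 1" by (intro k) auto
      moreover have "card (C - {\<zero>}) = q ^ d - 1" using finC C_closed(2) by (simp add: d)
      ultimately show "k * card {x \<in> carrier (units_of R).
         x \<otimes>\<^bsub>units_of R\<^esub> a = a \<otimes>\<^bsub>units_of R\<^esub> x} dvd Coset.order (units_of R)"
        by (simp add: ord U(2) cU C_def)
    qed
    moreover have "card (Z - {\<zero>}) = q - 1" using finZ Z_closed(2) by (simp add: q_def)
    ultimately have "k \<le> q - 1" using q2 by (auto intro: dvd_imp_le)
    moreover have "k > q - 1" using P(2)[of "int q"] q2 by (simp add: k_def)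
    ultimately show ?thesis by simp
  qed
qed

theorem wedderburn: "field R"
proof -
  interpret cring R by unfold_locales (rule commutative)
  show ?thesis using Units_eq by (rule cring_fieldI)
qed

end

section \<open>Finite skewfields of additive maps\<close>

lemma ring_maps_ring:
  fixes M :: "('a::field \<Rightarrow> 'a) set"
  assumes M: "M \<subseteq> End_over K" and id: "id \<in> M"
    and add: "\<And>f g. f \<in> M \<Longrightarrow> g \<in> M \<Longrightarrow> (\<lambda>x. f x + g x) \<in> M"
    and neg: "\<And>f. f \<in> M \<Longrightarrow> (\<lambda>x. - f x) \<in> M"
    and comp: "\<And>f g. f \<in> M \<Longrightarrow> g \<in> M \<Longrightarrow> f \<circ> g \<in> M"
  shows "ring (maps_ring M id)"
proof -
  have zero: "(\<lambda>x. 0) \<in> M" using add[OF id neg[OF id]] by (simp add: id_def)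
  have additive: "f (x + y) = f x + f y" if "f \<in> M" for f x y
    using M that by (auto simp: End_over_def)
  show ?thesis
  proof (intro ringI abelian_groupI monoidI)
    fix f assume "f \<in> carrier (maps_ring M id)"
    then show "\<exists>g\<in>carrier (maps_ring M id). g \<oplus>\<^bsub>maps_ring M id\<^esub> f = \<zero>\<^bsub>maps_ring M id\<^esub>"
      by (intro bexI[of _ "\<lambda>x. - f x"]) (auto simp: maps_ring_def neg)
  qed (auto simp: maps_ring_def fun_eq_iff add zero id comp additive algebra_simps)
qed

text \<open>Composition with an injective \<open>f\<close> permutes the finite set \<open>M\<close>, hence hits the identity map. So \<open>M\<close>
contains the inverse of each of its nonzero elements.\<close>

lemma finite_skewfield_maps_ring:
  fixes M :: "('a::finite_field \<Rightarrow> 'a) set"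
  assumes M: "M \<subseteq> End_over K" and id: "id \<in> M"
    and add: "\<And>f g. f \<in> M \<Longrightarrow> g \<in> M \<Longrightarrow> (\<lambda>x. f x + g x) \<in> M"
    and neg: "\<And>f. f \<in> M \<Longrightarrow> (\<lambda>x. - f x) \<in> M"
    and comp: "\<And>f g. f \<in> M \<Longrightarrow> g \<in> M \<Longrightarrow> f \<circ> g \<in> M"
    and inj: "\<And>f. f \<in> M \<Longrightarrow> f \<noteq> (\<lambda>x. 0) \<Longrightarrow> inj f"
  shows "finite_skewfield (maps_ring M id)"
proof -
  interpret ring "maps_ring M id" by (rule ring_maps_ring[OF M id add neg comp])
  have sel: "carrier (maps_ring M id) = M" "\<zero>\<^bsub>maps_ring M id\<^esub> = (\<lambda>x. 0)"
    "\<one>\<^bsub>maps_ring M id\<^esub> = id" "f \<otimes>\<^bsub>maps_ring M id\<^esub> g = f \<circ> g" for f g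
    by (simp_all add: maps_ring_def)
  have inverse: "\<exists>g\<in>M. g \<circ> f = id \<and> f \<circ> g = id" if f: "f \<in> M" "f \<noteq> (\<lambda>x. 0)" for f
  proof -
    have "inj f" by (rule inj[OF f])
    then have "inj_on (\<lambda>g. f \<circ> g) M" by (auto intro!: inj_onI simp: fun.inj_map_strong fun_eq_iff inj_eq)
    then have "(\<lambda>g. f \<circ> g) ` M = M" using comp f(1) by (intro endo_inj_surj) auto
    then obtain g where g: "g \<in> M" "f \<circ> g = id" using id by (metis imageE)
    have "f (g (f x)) = f x" for x using g(2) by (simp add: fun_eq_iff)
    then have "g \<circ> f = id" using \<open>inj f\<close> by (auto simp: fun_eq_iff inj_eq)
    with g show ?thesis by blast
  qed
  have "Units (maps_ring M id) = M - {\<lambda>x. 0}"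
  proof (intro equalityI subsetI)
    fix f assume "f \<in> M - {\<lambda>x. 0}"
    then show "f \<in> Units (maps_ring M id)" using inverse[of f] by (auto simp: Units_def sel)
  next
    fix f assume "f \<in> Units (maps_ring M id)"
    then obtain g where g: "f \<in> M" "g \<in> M" "g \<circ> f = id" by (auto simp: Units_def sel)
    moreover have "f \<noteq> (\<lambda>x. 0)"
    proof
      assume "f = (\<lambda>x. 0)"
      with g(3) have "g 0 = 0" "g 0 = 1" by (auto simp: fun_eq_iff)
      then show False by simp
    qed
    ultimately show "f \<in> M - {\<lambda>x. 0}" by simp
  qed
  then show ?thesis by unfold_locales (simp_all add: sel)
qed

text \<open>The common pattern of the three nuclei, with \<open>P f\<close> saying that composition with \<open>f\<close>, on the side in
question, preserves the spread set. By Wedderburn's theorem the set of all maps with this property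
is itself a field, so it is the largest one. It contains the scalar maps, and since it is
commutative its members commute with them, which is linearity over \<open>K\<close>.\<close>

lemma greatest_field_of_maps_over:
  fixes P :: "('a::finite_field \<Rightarrow> 'a) \<Rightarrow> bool"
  assumes id: "P id"
    and add: "\<And>f g. P f \<Longrightarrow> P g \<Longrightarrow> P (\<lambda>x. f x + g x)"
    and neg: "\<And>f. P f \<Longrightarrow> P (\<lambda>x. - f x)"
    and comp: "\<And>f g. P f \<Longrightarrow> P g \<Longrightarrow> P (f \<circ> g)"
    and inj: "\<And>f. f \<in> End_prime \<Longrightarrow> P f \<Longrightarrow> f \<noteq> (\<lambda>x. 0) \<Longrightarrow> inj f"
    and scalar: "\<And>c. c \<in> K \<Longrightarrow> P (\<lambda>x. c * x)"
  defines "N \<equiv> GREATEST N. field_of_maps N \<and> (\<forall>f\<in>N. P f)"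
  shows "scalar_maps K \<subseteq> N \<and> N \<subseteq> End_over K"
proof -
  define M where "M = {f \<in> End_prime. P f}"
  have ME: "M \<subseteq> End_over (range of_nat)" by (auto simp: M_def End_prime_def)
  have "finite_skewfield (maps_ring M id)"
  proof (rule finite_skewfield_maps_ring[OF ME])
    show "id \<in> M" using id by (simp add: M_def End_prime_def End_over_def)
    show "(\<lambda>x. f x + g x) \<in> M" if "f \<in> M" "g \<in> M" for f g
      using that add[of f g] by (auto simp: M_def End_prime_def End_over_def algebra_simps)
    show "(\<lambda>x. - f x) \<in> M" if "f \<in> M" for f
      using that neg[of f] by (auto simp: M_def End_prime_def End_over_def algebra_simps)
    show "f \<circ> g \<in> M" if "f \<in> M" "g \<in> M" for f g
      using that comp[of f g] by (auto simp: M_def End_prime_def End_over_def)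
    show "inj f" if "f \<in> M" "f \<noteq> (\<lambda>x. 0)" for f
      using that inj[of f] by (auto simp: M_def)
  qed
  then interpret finite_skewfield "maps_ring M id" .
  have "field (maps_ring M id)" by (rule wedderburn)
  then have "N = M"
    unfolding N_def by (intro Greatest_equality) (auto simp: M_def field_of_maps_def)
  moreover have sM: "scalar_maps K \<subseteq> M"
    using scalar by (auto simp: scalar_maps_def M_def End_prime_def End_over_def algebra_simps)
  moreover have "M \<subseteq> End_over K"
  proof
    fix f assume f: "f \<in> M"
    have "f (c * x) = c * f x" if "c \<in> K" for c x
    proof -
      have "(\<lambda>x. c * x) \<in> M" using sM that by (auto simp: scalar_maps_def)
      then have "f \<circ> (\<lambda>x. c * x) = (\<lambda>x. c * x) \<circ> f"
        using commutative[of f "\<lambda>x. c * x"] f by (simp add: maps_ring_def)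
      then show ?thesis by (simp add: fun_eq_iff)
    qed
    then show "f \<in> End_over K" using f ME by (auto simp: End_over_def)
  qed
  ultimately show ?thesis by simp
qed

section \<open>Nuclei of presemifields\<close>

lemma presemifield_dual: "presemifield m \<Longrightarrow> presemifield (dual_mult m)"
  by (auto simp: presemifield_def dual_mult_def)

context
  fixes m :: "'a::finite_field \<Rightarrow> 'a \<Rightarrow> 'a"
  assumes m: "presemifield m"
begin

lemma presemifield_zero_minus: "m (- x) y = - m x y" "m x (- y) = - m x y" "m 0 y = 0" "m x 0 = 0"
proof -
  have l: "m (u + v) w = m u w + m v w" and r: "m u (v + w) = m u v + m u w" for u v w
    using m by (auto simp: presemifield_def)
  show l0: "m 0 y = 0" and r0: "m x 0 = 0" using l[of 0 0 y] r[of x 0 0] by (metis add_0 add_right_cancel)+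
  show "m (- x) y = - m x y" using l[of x "-x" y] l0 by (simp add: eq_neg_iff_add_eq_0 add.commute)
  show "m x (- y) = - m x y" using r[of x y "-y"] r0 by (simp add: eq_neg_iff_add_eq_0 add.commute)
qed

lemma bij_mult_right: "y \<noteq> 0 \<Longrightarrow> bij (\<lambda>x. m x y)"
proof -
  assume "y \<noteq> 0"
  have "inj (\<lambda>x. m x y)"
  proof (rule injI)
    fix u v assume "m u y = m v y"
    moreover have "m (u + - v) y = m u y + m (- v) y" using m unfolding presemifield_def by blast
    ultimately have "m (u + - v) y = 0" by (simp add: presemifield_zero_minus)
    then have "u + - v = 0" using m \<open>y \<noteq> 0\<close> unfolding presemifield_def by blast
    then show "u = v" by simp
  qed
  then show ?thesis by (simp add: bij_def finite_UNIV_inj_surj)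
qed

lemma spread_set_add: "f \<in> spread_set m \<Longrightarrow> g \<in> spread_set m \<Longrightarrow> (\<lambda>x. f x + g x) \<in> spread_set m"
  using m by (auto simp: spread_set_def presemifield_def image_iff fun_eq_iff) metis

lemma spread_set_minus: "f \<in> spread_set m \<Longrightarrow> (\<lambda>x. - f x) \<in> spread_set m"
  by (auto simp: spread_set_def simp flip: presemifield_zero_minus(2))

lemma spread_set_bij:
  assumes "f \<in> spread_set m" "f \<noteq> (\<lambda>x. 0)"
  shows "bij f"
proof -
  obtain y where f: "f = (\<lambda>x. m x y)" using assms(1) by (auto simp: spread_set_def)
  have "y \<noteq> 0" using assms(2) by (auto simp: f presemifield_zero_minus)
  then show ?thesis unfolding f by (rule bij_mult_right)
qed

lemma spread_set_additive: "f \<in> spread_set m \<Longrightarrow> f (x + y) = f x + f y"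
  using m by (auto simp: spread_set_def presemifield_def)

lemma spread_set_bij_exists: obtains g where "g \<in> spread_set m" "bij g"
  using bij_mult_right[of 1] by (auto simp: spread_set_def)

text \<open>If \<open>f\<close> preserves the spread set and \<open>g\<close> is a bijection in it, then \<open>f \<circ> g\<close> is in the spread set
and so is zero or bijective. Therefore \<open>f\<close> is zero or bijective, as the general pattern requires.\<close>

lemma right_nucleus_over:
  assumes scalar: "\<And>c g. c \<in> K \<Longrightarrow> g \<in> spread_set m \<Longrightarrow> (\<lambda>x. c * x) \<circ> g \<in> spread_set m"
  shows "scalar_maps K \<subseteq> right_nucleus m \<and> right_nucleus m \<subseteq> End_over K"
proof -
  define P where "P f \<longleftrightarrow> (\<forall>g\<in>spread_set m. f \<circ> g \<in> spread_set m)" for f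
  have "comp_sets N (spread_set m) \<subseteq> spread_set m \<longleftrightarrow> (\<forall>f\<in>N. P f)" for N
    by (auto simp: comp_sets_def P_def)
  then have "right_nucleus m = (GREATEST N. field_of_maps N \<and> (\<forall>f\<in>N. P f))"
    by (simp add: right_nucleus_def)
  moreover have "scalar_maps K \<subseteq> (GREATEST N. field_of_maps N \<and> (\<forall>f\<in>N. P f)) \<and>
      (GREATEST N. field_of_maps N \<and> (\<forall>f\<in>N. P f)) \<subseteq> End_over K"
  proof (rule greatest_field_of_maps_over)
    show "P (\<lambda>x. f x + g x)" if "P f" "P g" for f g
      unfolding P_def
    proof
      fix h assume "h \<in> spread_set m"
      then show "(\<lambda>x. f x + g x) \<circ> h \<in> spread_set m"
        using spread_set_add[of "f \<circ> h" "g \<circ> h"] that by (simp add: P_def comp_def)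
    qed
    show "P (\<lambda>x. - f x)" if "P f" for f
      unfolding P_def
    proof
      fix h assume "h \<in> spread_set m"
      then show "(\<lambda>x. - f x) \<circ> h \<in> spread_set m"
        using spread_set_minus[of "f \<circ> h"] that by (simp add: P_def comp_def)
    qed
    show "inj f" if f: "P f" "f \<noteq> (\<lambda>x. 0)" for f
    proof -
      obtain g where g: "g \<in> spread_set m" "bij g" by (rule spread_set_bij_exists)
      have "f \<circ> g \<noteq> (\<lambda>x. 0)"
      proof
        assume "f \<circ> g = (\<lambda>x. 0)"
        then have "f x = 0" for x using bij_is_surj[OF g(2)] by (metis comp_apply surj_def)
        with f(2) show False by (simp add: fun_eq_iff)
      qed
      then have "bij (f \<circ> g)" using f(1) g(1) by (intro spread_set_bij) (auto simp: P_def)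
      then have "bij f" using g(2) by (metis bij_betw_comp_iff2 bij_betw_comp_iff)
      then show ?thesis by (rule bij_is_inj)
    qed
  qed (auto simp: P_def scalar comp_assoc)
  ultimately show ?thesis by simp
qed

text \<open>The argument for the right nucleus applies with compositions reversed. Sums of maps are now inside
the elements of the spread set, which are additive.\<close>

lemma middle_nucleus_over:
  assumes scalar: "\<And>c g. c \<in> K \<Longrightarrow> g \<in> spread_set m \<Longrightarrow> g \<circ> (\<lambda>x. c * x) \<in> spread_set m"
  shows "scalar_maps K \<subseteq> middle_nucleus m \<and> middle_nucleus m \<subseteq> End_over K"
proof -
  define P where "P f \<longleftrightarrow> (\<forall>g\<in>spread_set m. g \<circ> f \<in> spread_set m)" for f
  have "comp_sets (spread_set m) N \<subseteq> spread_set m \<longleftrightarrow> (\<forall>f\<in>N. P f)" for N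
    by (auto simp: comp_sets_def P_def)
  then have "middle_nucleus m = (GREATEST N. field_of_maps N \<and> (\<forall>f\<in>N. P f))"
    by (simp add: middle_nucleus_def)
  moreover have "scalar_maps K \<subseteq> (GREATEST N. field_of_maps N \<and> (\<forall>f\<in>N. P f)) \<and>
      (GREATEST N. field_of_maps N \<and> (\<forall>f\<in>N. P f)) \<subseteq> End_over K"
  proof (rule greatest_field_of_maps_over)
    show "P (\<lambda>x. f x + g x)" if "P f" "P g" for f g
      unfolding P_def
    proof
      fix h assume "h \<in> spread_set m"
      then show "h \<circ> (\<lambda>x. f x + g x) \<in> spread_set m"
        using spread_set_add[of "h \<circ> f" "h \<circ> g"] that by (simp add: P_def comp_def spread_set_additive)
    qed
    show "P (\<lambda>x. - f x)" if "P f" for f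
      unfolding P_def
    proof
      fix h assume h: "h \<in> spread_set m"
      then have "h (- x) = - h x" for x
        by (auto simp: spread_set_def presemifield_zero_minus)
      then show "h \<circ> (\<lambda>x. - f x) \<in> spread_set m"
        using spread_set_minus[of "h \<circ> f"] that h by (simp add: P_def comp_def)
    qed
    show "inj f" if f: "P f" "f \<noteq> (\<lambda>x. 0)" for f
    proof -
      obtain g where g: "g \<in> spread_set m" "bij g" by (rule spread_set_bij_exists)
      have "g 0 = 0" using g(1) by (auto simp: spread_set_def presemifield_zero_minus)
      have "g \<circ> f \<noteq> (\<lambda>x. 0)"
      proof
        assume "g \<circ> f = (\<lambda>x. 0)"
        then have "g (f x) = g 0" for x using \<open>g 0 = 0\<close> by (simp add: fun_eq_iff)
        then have "f x = 0" for x using bij_is_inj[OF g(2)] by (simp add: inj_eq)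
        with f(2) show False by (simp add: fun_eq_iff)
      qed
      then have "bij (g \<circ> f)" using f(1) g(1) by (intro spread_set_bij) (auto simp: P_def)
      then show ?thesis by (metis bij_is_inj inj_on_imageI2)
    qed
  qed (auto simp: P_def scalar comp_assoc[symmetric])
  ultimately show ?thesis by simp
qed

text \<open>Every \<open>c \<in> K\<close> has the form \<open>\<sigma> l\<close>, and multiplying the values of \<open>x \<mapsto> m x y\<close> by \<open>\<sigma> l\<close> yields
\<open>x \<mapsto> m x (l y)\<close>.\<close>

lemma right_nucleus_over_if_semilinear_y:
  assumes "semilinear_y K m"
  shows "scalar_maps K \<subseteq> right_nucleus m \<and> right_nucleus m \<subseteq> End_over K"
proof (rule right_nucleus_over)
  fix c g assume c: "c \<in> K" and "g \<in> spread_set m"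
  then obtain y where g: "g = (\<lambda>x. m x y)" by (auto simp: spread_set_def)
  obtain \<sigma> where \<sigma>: "\<sigma> \<in> field_aut K" "\<And>x y l. l \<in> K \<Longrightarrow> m x (l * y) = \<sigma> l * m x y"
    using assms by (auto simp: semilinear_y_def)
  have "\<sigma> ` K = K" using ring_iso_memE(5)[OF \<sigma>(1)[unfolded field_aut_def]] by (simp add: bij_betw_def)
  then obtain l where l: "l \<in> K" "c = \<sigma> l" using c by auto
  then have "(\<lambda>x. c * x) \<circ> g = (\<lambda>x. m x (l * y))" by (simp add: g \<sigma>(2) fun_eq_iff)
  then show "(\<lambda>x. c * x) \<circ> g \<in> spread_set m" by (auto simp: spread_set_def)
qed

end

theorem theorem2p5:
  fixes p n :: nat
    and a :: "nat \<Rightarrow> nat \<Rightarrow> 'a::finite_field"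
    and F :: "'a \<Rightarrow> 'a \<Rightarrow> 'a"
    and Fq :: "'a set"
  assumes "Factorial_Ring.prime p"
    and "CARD('a) = p ^ n"
    and "F = (\<lambda>x y. \<Sum>i<n. \<Sum>j<n. a i j * x ^ (p ^ i) * y ^ (p ^ j))"
    and "presemifield F"
    and "subfield Fq ring_of_type_algebra"
  shows
    "((\<exists>\<tau>\<in>field_aut Fq. \<forall>x y. \<forall>l\<in>Fq. F (l * x) y = F x (\<tau> l * y)) \<longrightarrow>
        scalar_maps Fq \<subseteq> middle_nucleus F \<and> middle_nucleus F \<subseteq> End_over Fq) \<and>
     (semilinear_y Fq F \<longrightarrow>
        scalar_maps Fq \<subseteq> right_nucleus F \<and> right_nucleus F \<subseteq> End_over Fq) \<and>
     (semilinear_x Fq F \<longrightarrow>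
        scalar_maps Fq \<subseteq> left_nucleus F \<and> left_nucleus F \<subseteq> End_over Fq)"
proof (intro conjI[of "_ \<longrightarrow> _"] impI)
  note F = \<open>presemifield F\<close>
  assume "\<exists>\<tau>\<in>field_aut Fq. \<forall>x y. \<forall>l\<in>Fq. F (l * x) y = F x (\<tau> l * y)"
  then obtain \<tau> where \<tau>: "\<And>x y l. l \<in> Fq \<Longrightarrow> F (l * x) y = F x (\<tau> l * y)" by blast
  show "scalar_maps Fq \<subseteq> middle_nucleus F \<and> middle_nucleus F \<subseteq> End_over Fq"
    by (rule middle_nucleus_over[OF F]) (auto simp: spread_set_def comp_def \<tau>)
next
  assume "semilinear_y Fq F"
  then show "scalar_maps Fq \<subseteq> right_nucleus F \<and> right_nucleus F \<subseteq> End_over Fq"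
    by (rule right_nucleus_over_if_semilinear_y[OF \<open>presemifield F\<close>])
next
  assume "semilinear_x Fq F"
  then have "semilinear_y Fq (dual_mult F)"
    by (simp add: semilinear_x_def semilinear_y_def dual_mult_def) blast
  \<comment> \<open>The left nucleus is by definition the right nucleus of the dual, and dualizing exchanges the two variables.\<close>
  moreover have "left_nucleus F = right_nucleus (dual_mult F)"
    by (simp add: left_nucleus_def right_nucleus_def)
  ultimately show "scalar_maps Fq \<subseteq> left_nucleus F \<and> left_nucleus F \<subseteq> End_over Fq"
    using right_nucleus_over_if_semilinear_y[OF presemifield_dual[OF \<open>presemifield F\<close>]] by simp
qed

end
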